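(* Let $p$ and $q$ be distinct primes with $\gcd(p-1,q-1)=4$, and let $(e_u)$ be the quaternary sequence over $\mathbb{Z}_4$ of period $pq$ defined in the context. The linear complexity $LC((e_u))$ over $\mathbb{Z}_4$ satisfies the following. If $p\equiv 5\pmod 8$ and $q\equiv 5\pmod 8$, then $$LC((e_u))=p+(p-1)(q-1)\quad\text{or}\quad LC((e_u))=p+(p-1)(q-1)-\frac{(p-1)(q-1)}{4}.$$ If $p\equiv 1\pmod 8$ and $q\equiv 5\pmod 8$, then $$LC((e_u))=p+q-1+(p-1)(q-1)\quad\text{or}\quad LC((e_u))=p+q-1+(p-1)(q-1)-\frac{(p-1)(q-1)}{4}.$$ If $p\equiv 5\pmod 8$ and $q\equiv 1\pmod 8$, then $$LC((e_u))=1+(p-1)(q-1)\quad\text{or}\quad LC((e_u))=1+(p-1)(q-1)-\frac{(p-1)(q-1)}{4}.$$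
   Context: $\mathbb{Z}_m=\{0,1,\dots,m-1\}$ is the residue class ring modulo $m$. $p,q$ are distinct primes with $\gcd(p-1,q-1)=4$, and $e=(p-1)(q-1)/4$. Fix an integer $g$ that is a common primitive root of both $p$ and $q$, and an integer $h$ with $h\equiv g\pmod p$, $h\equiv 1\pmod q$. The generalized cyclotomic classes of order $4$ modulo $pq$ are $D_i=\{g^sh^i \bmod pq: s=0,1,\dots,e-1\}$ for $0\le i<4$; they partition $\mathbb{Z}_{pq}^*$. Let $P=\{p,2p,\dots,(q-1)p\}$, $Q=\{q,2q,\dots,(p-1)q\}$, $R=\{0\}$. The sequence $(e_u)_{u\ge 0}$ over $\mathbb{Z}_4$ of period $pq$ is: $e_u=2$ if $u\bmod pq\in Q\cup R$; $e_u=0$ if $u\bmod pq\in P$; $e_u=i$ if $u\bmod pq\in D_i$, $i=0,1,2,3$. The linear complexity $LC((s_u))$ of a periodic sequence $(s_u)$ over $\mathbb{Z}_4$ is the least order $L$ of a linear recurrence relation $s_{u+L}+c_1s_{u+L-1}+\dots+c_{L-1}s_{u+1}+c_Ls_u=0$ for all $u\ge 0$, with $c_1,\dots,c_L\in\mathbb{Z}_4$, satisfied by $(s_u)$. *)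

theory Defs
  imports
    "HOL-Library.Numeral_Type"
    "HOL-Number_Theory.Residue_Primitive_Roots"
begin

(* The library notion residue_primroot is for natural numbers; an integer is judged by its
   least nonnegative residue. *)
definition int_primroot :: "nat \<Rightarrow> int \<Rightarrow> bool" where
  "int_primroot m g \<longleftrightarrow> residue_primroot m (nat (g mod int m))"

definition cyc_class :: "nat \<Rightarrow> nat \<Rightarrow> int \<Rightarrow> int \<Rightarrow> nat \<Rightarrow> nat set" where
  "cyc_class p q g h i =
     {nat ((g ^ s * h ^ i) mod int (p * q)) | s. s < (p - 1) * (q - 1) div 4}"

definition P_set :: "nat \<Rightarrow> nat \<Rightarrow> nat set" where
  "P_set p q = {k * p | k. 1 \<le> k \<and> k \<le> q - 1}"

definition Q_set :: "nat \<Rightarrow> nat \<Rightarrow> nat set" where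
  "Q_set p q = {k * q | k. 1 \<le> k \<and> k \<le> p - 1}"

definition R_set :: "nat set" where
  "R_set = {0}"

(* The result type 4 is the ring of integers modulo 4 from HOL-Library.Numeral_Type.
   The classes of index 0, 1, 2, 3 partition the units modulo p * q, so for the intended
   parameters the index selected in the last branch exists and is unique. *)
definition quat_seq :: "nat \<Rightarrow> nat \<Rightarrow> int \<Rightarrow> int \<Rightarrow> nat \<Rightarrow> 4" where
  "quat_seq p q g h u =
     (let v = u mod (p * q) in
      if v \<in> Q_set p q \<union> R_set then 2
      else if v \<in> P_set p q then 0
      else of_nat (THE i. i < 4 \<and> v \<in> cyc_class p q g h i))"

definition satisfies_recurrence ::
    "(nat \<Rightarrow> 'a::comm_ring_1) \<Rightarrow> nat \<Rightarrow> (nat \<Rightarrow> 'a) \<Rightarrow> bool" where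
  "satisfies_recurrence s L c \<longleftrightarrow>
     (\<forall>u. s (u + L) + (\<Sum>i = 1..L. c i * s (u + L - i)) = 0)"

(* Order 0 is allowed, and only the zero sequence has it.  A sequence of period N > 0
   satisfies a recurrence of order N, so for periodic sequences the minimum exists. *)
definition linear_complexity :: "(nat \<Rightarrow> 'a::comm_ring_1) \<Rightarrow> nat" where
  "linear_complexity s = (LEAST L. \<exists>c. satisfies_recurrence s L c)"

end

theory Submission
  imports "HOL-Library.Z2" "HOL-Algebra.Algebraic_Closure_Type" Defs
begin

text \<open>Let \<open>K\<close> be the algebraic closure of the field with two elements. The ring of Witt vectors of
  length two over \<open>K\<close> contains the integers modulo 4 as the fixed ring of its Frobenius map, and
  differences of distinct powers of a Teichmueller lift \<open>\<zeta>\<close> of a primitive \<open>N\<close>-th root of unity,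
  \<open>N\<close> odd, are units. Hence the linear complexity of a sequence of period \<open>N\<close> is the number of
  \<open>k < N\<close> at which its discrete Fourier transform is nonzero: a monic annihilating polynomial
  vanishes modulo 2 at all inverse roots \<open>\<zeta>\<^sup>-\<^sup>k\<close> with nonzero transform, and the product of
  the corresponding linear factors has Frobenius invariant coefficients.

  For the quaternary sequence with \<open>N = p q\<close> the transform at \<open>k\<close> is \<open>2\<close> if \<open>k = 0\<close>, it is
  \<open>- 2 (q - 1) / 4\<close> if \<open>q\<close> divides \<open>k \<noteq> 0\<close>, and \<open>2 - 2 (p - 1) / 4\<close> if \<open>p\<close> divides
  \<open>k \<noteq> 0\<close>. Since the primitive \<open>N\<close>-th roots of unity add up to 1, it equals \<open>T - j\<close> for
  \<open>k\<close> in the class \<open>D\<^sub>j\<close>, with \<open>T\<close> independent of \<open>j\<close>; so it vanishes on at most one of the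
  four classes.\<close>

section \<open>Witt vectors of length two in characteristic two\<close>

text \<open>A type class lets the Witt vectors over any such field become an instance of
  \<open>comm_ring_1\<close>, so that polynomials over them are available.\<close>

class field_char_2 = field +
  assumes one_plus_one_eq_0: "1 + 1 = 0"
begin

lemma add_self_char_2 [simp]: "x + x = 0"
  by (metis distrib_left mult_1_right mult_zero_right one_plus_one_eq_0)

lemma uminus_char_2 [simp]: "- x = x"
  by (rule minus_unique) simp

lemma add_self_left_char_2 [simp]: "x + (x + y) = y"
  by (simp flip: add.assoc)

lemma power2_add_char_2: "(x + y) ^ 2 = x ^ 2 + y ^ 2"
  by (simp add: power2_eq_square algebra_simps)

end

instance bit :: field_char_2
  by standard simp

instance alg_closure :: (field_char_2) field_char_2
proof
  have "(1 + 1 :: 'a alg_closure) = to_ac (1 + 1)"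
    by (simp only: to_ac_add to_ac_1)
  thus "(1 + 1 :: 'a alg_closure) = 0"
    by (simp add: one_plus_one_eq_0)
qed

text \<open>\<open>Witt a b\<close> stands for the Witt vector \<open>(a, b)\<close>. The operations below are the Witt
  polynomials for the prime 2 with coefficients reduced modulo 2; for instance the carry of a sum is
  \<open>(x\<^sup>2 + y\<^sup>2 - (x + y)\<^sup>2) / 2 = - x y\<close>.\<close>

datatype 'a witt = Witt (residue: 'a) (carry: 'a)

instantiation witt :: (field_char_2) comm_ring_1
begin

definition "0 = Witt 0 0"
definition "1 = Witt 1 0"
definition "x + y = Witt (residue x + residue y) (carry x + carry y + residue x * residue y)"
text \<open>This is multiplication by -1 = 3 = (1, 1): the residue is its own negative, and the
  carry absorbs the correction.\<close>

definition "- x = Witt (residue x) (carry x + residue x ^ 2)"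
definition "x - y = x + - (y :: 'a witt)"
definition "x * y =
  Witt (residue x * residue y) (residue x ^ 2 * carry y + residue y ^ 2 * carry x)"

instance
  by standard
    (simp_all add: zero_witt_def one_witt_def plus_witt_def uminus_witt_def minus_witt_def
      times_witt_def power2_add_char_2 power_mult_distrib algebra_simps power2_eq_square)

end

lemma residue_simps [simp]:
  fixes x y :: "'a::field_char_2 witt"
  shows "residue (0 :: 'a witt) = 0" "residue (1 :: 'a witt) = 1"
    "residue (x + y) = residue x + residue y" "residue (- x) = - residue x"
    "residue (x - y) = residue x - residue y" "residue (x * y) = residue x * residue y"
    "residue (x ^ n) = residue x ^ n"
proof -
  show mult: "residue (x * y) = residue x * residue y" for x y :: "'a witt"
    by (simp add: times_witt_def)
  show one: "residue (1 :: 'a witt) = 1"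
    by (simp add: one_witt_def)
  show "residue (x ^ n) = residue x ^ n"
    by (induction n) (simp_all add: mult one)
qed (simp_all add: zero_witt_def plus_witt_def uminus_witt_def minus_witt_def diff_conv_add_uminus
       del: add_uminus_conv_diff)

lemma residue_sum: "residue (sum f A) = (\<Sum>x\<in>A. residue (f x :: 'a::field_char_2 witt))"
  by (induction A rule: infinite_finite_induct) simp_all

lemma residue_of_nat: "residue (of_nat n :: 'a::field_char_2 witt) = of_nat n"
  by (induction n) simp_all

lemma of_nat_odd_char_2: "odd n \<Longrightarrow> (of_nat n :: 'a::field_char_2) = 1"
  by (elim oddE) (simp add: mult_2)

lemma witt_4_eq_0: "(4 :: 'a::field_char_2 witt) = 0"
proof -
  have "(4 :: 'a witt) = (1 + 1) + (1 + 1)"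
    by simp
  thus ?thesis
    by (simp only: one_witt_def plus_witt_def zero_witt_def) simp
qed

lemma witt_2_eq: "(2 :: 'a::field_char_2 witt) = Witt 0 1"
proof -
  have "(2 :: 'a witt) = 1 + 1"
    by simp
  thus ?thesis
    by (simp only: one_witt_def plus_witt_def) simp
qed

lemma witt_3_eq: "(3 :: 'a::field_char_2 witt) = Witt 1 1"
proof -
  have "(3 :: 'a witt) = 2 + 1"
    by simp
  thus ?thesis
    by (simp only: one_witt_def witt_2_eq plus_witt_def) simp
qed

text \<open>The ring is local, with the vectors of residue 0 as maximal ideal. The inverse of (a, c)
  is (1/a, c/a^4): the product has carry c/a^2 + c/a^2 = 0.\<close>

lemma witt_dvd_1:
  fixes x :: "'a::field_char_2 witt"
  assumes "residue x \<noteq> 0"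
  shows "x dvd 1"
proof
  define a where "a = residue x"
  define c where "c = carry x"
  have x: "x = Witt a c"
    by (simp add: a_def c_def)
  have "a\<^sup>2 * (c / (a\<^sup>2 * a\<^sup>2)) = c / a\<^sup>2"
    using nonzero_mult_divide_mult_cancel_left[of "a\<^sup>2" c "a\<^sup>2"] assms by (simp only: a_def) simp
  moreover have "(1 / a)\<^sup>2 * c = c / a\<^sup>2"
    by (simp add: power_divide)
  moreover have "a * (1 / a) = 1"
    using assms by (simp add: a_def)
  ultimately show "1 = x * Witt (1 / a) (c / (a\<^sup>2 * a\<^sup>2))"
    by (simp only: x times_witt_def one_witt_def witt.sel add_self_char_2)
qed

text \<open>Cancellation of units. It stands in for integrality, which fails because 2 * 2 =
  0.\<close>

lemma witt_mult_eq_0D: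
  fixes x y :: "'a::field_char_2 witt"
  assumes "x * y = 0" and "residue x \<noteq> 0"
  shows "y = 0"
proof -
  from witt_dvd_1[OF assms(2)] obtain z where "1 = x * z" ..
  hence "y = (x * z) * y"
    by simp
  also have "\<dots> = z * (x * y)"
    by (simp only: mult_ac)
  finally have "y = z * (x * y)" .
  thus ?thesis
    using assms(1) by simp
qed

text \<open>The characteristic is exactly 4: the numbers 0, 1, 2, 3 are the distinct vectors (0,0),
  (1,0), (0,1), (1,1).\<close>

lemma of_nat_witt_eq_0_iff: "of_nat n = (0 :: 'a::field_char_2 witt) \<longleftrightarrow> 4 dvd n"
proof -
  have "of_nat n = (of_nat (4 * (n div 4) + n mod 4) :: 'a witt)"
    by simp
  also have "\<dots> = of_nat (n mod 4)"
    by (simp only: of_nat_add of_nat_mult of_nat_numeral witt_4_eq_0) simp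
  finally have *: "of_nat n = (of_nat (n mod 4) :: 'a witt)" .
  have "n mod 4 = 0 \<or> n mod 4 = 1 \<or> n mod 4 = 2 \<or> n mod 4 = 3"
    by linarith
  thus ?thesis
    unfolding * dvd_eq_mod_eq_0
    by (elim disjE) (simp_all only: of_nat_numeral of_nat_0 of_nat_1 witt_2_eq witt_3_eq one_witt_def zero_witt_def, simp_all)
qed

section \<open>Teichmueller lifts, the Frobenius map and the integers modulo 4\<close>

definition teich :: "'a \<Rightarrow> 'a::field_char_2 witt" where
  "teich a = Witt a 0"

lemma residue_teich [simp]: "residue (teich a) = a"
  by (simp add: teich_def)

lemma teich_mult: "teich (a * b) = teich a * teich b"
  by (simp add: teich_def times_witt_def)

lemma teich_power: "teich a ^ n = teich (a ^ n)"
  by (induction n) (simp_all add: teich_def one_witt_def times_witt_def)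

lemma teich_1 [simp]: "teich 1 = 1"
  by (simp add: teich_def one_witt_def)

text \<open>Squaring each coordinate respects the ring operations because squaring is additive in
  characteristic 2.\<close>

definition frob :: "'a::field_char_2 witt \<Rightarrow> 'a witt" where
  "frob x = Witt (residue x ^ 2) (carry x ^ 2)"

lemma frob_0 [simp]: "frob 0 = 0"
  and frob_1 [simp]: "frob 1 = 1"
  and frob_add: "frob (x + y) = frob x + frob y"
  and frob_uminus: "frob (- x) = - frob x"
  and frob_mult: "frob (x * y) = frob x * frob y"
  and frob_teich: "frob (teich a) = teich (a ^ 2)"
  by (simp_all add: frob_def teich_def zero_witt_def one_witt_def plus_witt_def uminus_witt_def
      times_witt_def power2_add_char_2 power_mult_distrib)

lemma frob_diff: "frob (x - y) = frob x - frob y"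
  using frob_add[of x "- y"] by (simp add: frob_uminus)

lemma frob_sum: "frob (sum f A) = (\<Sum>x\<in>A. frob (f x))"
  by (induction A rule: infinite_finite_induct) (simp_all add: frob_add)

lemma frob_eq_0_iff [simp]: "frob x = 0 \<longleftrightarrow> x = 0"
  by (cases x) (simp add: frob_def zero_witt_def)

text \<open>The embedding of the integers modulo 4, by way of the integer representative. It is a
  ring homomorphism because 4 = 0 among the Witt vectors.\<close>

definition of_Z4 :: "4 \<Rightarrow> 'a::field_char_2 witt" where
  "of_Z4 z = of_int (Rep_bit0 z)"

lemma of_int_witt_mod_4: "(of_int (n mod 4) :: 'a::field_char_2 witt) = of_int n"
proof -
  have "(of_int n :: 'a witt) = of_int (4 * (n div 4) + n mod 4)"
    by simp
  also have "\<dots> = of_int (n mod 4)"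
    by (simp only: of_int_add of_int_mult of_int_numeral witt_4_eq_0) simp
  finally show ?thesis ..
qed

lemma of_Z4_of_int [simp]: "of_Z4 (of_int n) = of_int n"
  unfolding of_Z4_def bit0.of_int_eq bit0.Rep_Abs_mod by (simp add: of_int_witt_mod_4)

lemma of_Z4_0 [simp]: "of_Z4 0 = 0"
  and of_Z4_1 [simp]: "of_Z4 1 = 1"
  using of_Z4_of_int[of 0] of_Z4_of_int[of 1] by simp_all

lemma of_Z4_of_nat [simp]: "of_Z4 (of_nat n) = of_nat n"
  using of_Z4_of_int[of "int n"] by simp

lemma of_Z4_2 [simp]: "of_Z4 2 = 2"
  using of_Z4_of_nat[of 2] by simp

lemma of_Z4_add: "of_Z4 (x + y) = of_Z4 x + of_Z4 y"
  by (cases x; cases y) (simp flip: of_int_add)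

lemma of_Z4_mult: "of_Z4 (x * y) = of_Z4 x * of_Z4 y"
  by (cases x; cases y) (simp flip: of_int_mult)

lemma of_Z4_sum: "of_Z4 (sum f A) = (\<Sum>x\<in>A. of_Z4 (f x))"
  by (induction A rule: infinite_finite_induct) (simp_all add: of_Z4_add)

lemma of_Z4_eq_0_iff [simp]: "of_Z4 x = 0 \<longleftrightarrow> x = 0"
proof
  assume "of_Z4 x = (0 :: 'a witt)"
  moreover obtain n where n: "x = of_int n" "0 \<le> n" "n < 4"
    by (cases x) auto
  ultimately have "of_nat (nat n) = (0 :: 'a witt)"
    by simp
  hence "4 dvd nat n"
    by (simp only: of_nat_witt_eq_0_iff)
  hence "n = 0"
    using n by (auto dest: dvd_imp_le)
  thus "x = 0"
    using n by simp
qed simp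

text \<open>A coordinate equal to its own square is 0 or 1, which leaves exactly the four vectors 0,
  1, 2, 3.\<close>

lemma frob_fixed_iff: "frob x = x \<longleftrightarrow> x \<in> range of_Z4"
proof
  assume "frob x = x"
  hence "residue x ^ 2 = residue x" "carry x ^ 2 = carry x"
    by (cases x; simp add: frob_def)+
  hence "residue x \<in> {0, 1}" "carry x \<in> {0, 1}"
    by (simp_all add: power2_eq_square)
  hence "x \<in> {of_nat 0, of_nat 1, of_nat 2, of_nat 3}"
    by (cases x) (auto simp: zero_witt_def one_witt_def witt_2_eq witt_3_eq)
  thus "x \<in> range of_Z4"
    by (metis empty_iff insertE of_Z4_of_nat rangeI)
next
  assume "x \<in> range of_Z4"
  then obtain z where "x = of_Z4 z"
    by auto
  moreover obtain n where n: "z = of_int n" "0 \<le> n" "n < 4"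
    by (cases z) auto
  hence "of_Z4 z = (of_nat (nat n) :: 'a witt)"
    by simp
  moreover have "frob (of_nat m :: 'a witt) = of_nat m" for m
    by (induction m) (simp_all add: frob_add)
  ultimately show "frob x = x"
    by simp
qed

section \<open>Linear complexity over the integers modulo four\<close>

lemma sum_shift_periodic:
  fixes f :: "nat \<Rightarrow> 'a::cancel_comm_monoid_add"
  assumes "\<And>u. f (u + N) = f u"
  shows "(\<Sum>u<N. f (u + t)) = (\<Sum>u<N. f u)"
proof (induction t)
  case (Suc t)
  have "f t + (\<Sum>u<N. f (u + Suc t)) = (\<Sum>u<Suc N. f (u + t))"
    unfolding sum.lessThan_Suc_shift by simp
  also have "\<dots> = f t + (\<Sum>u<N. f (u + t))"
    using assms[of t] by (simp add: add.commute)
  finally show ?case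
    using Suc by simp
qed simp

text \<open>The factor \<open>teich a - 1\<close> of \<open>teich a ^ N - 1 = 0\<close> is a unit,
  its residue being a - 1, and cancels.\<close>

lemma sum_teich_power_eq_0:
  assumes "a ^ N = 1" and "a \<noteq> 1"
  shows "(\<Sum>k<N. teich a ^ k) = 0"
proof (rule witt_mult_eq_0D)
  show "(teich a - 1) * (\<Sum>k<N. teich a ^ k) = 0"
    using power_diff_1_eq[of "teich a" N] assms(1) by (simp add: teich_power)
  show "residue (teich a - 1) \<noteq> 0"
    using assms(2) by simp
qed

text \<open>Degrees need not add up over a ring with zero divisors. Multiplication by a linear
  factor is therefore written as a shift minus a scalar multiple, whose top coefficient is
  visible.\<close>

lemma monic_prod_linear_factors:
  fixes r :: "'b \<Rightarrow> 'a::comm_ring_1"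
  assumes "finite A"
  shows "degree (\<Prod>k\<in>A. [:- r k, 1:]) = card A \<and> coeff (\<Prod>k\<in>A. [:- r k, 1:]) (card A) = 1"
  using assms
proof (induction A rule: finite_induct)
  case (insert k A)
  let ?F = "\<Prod>k\<in>A. [:- r k, 1:]"
  have eq: "(\<Prod>k\<in>insert k A. [:- r k, 1:]) = pCons 0 ?F - smult (r k) ?F"
    using insert by simp
  have "coeff (pCons 0 ?F - smult (r k) ?F) (Suc (card A)) = 1"
    using insert by (simp add: coeff_eq_0)
  moreover have "degree (pCons 0 ?F - smult (r k) ?F) \<le> Suc (card A)"
    using insert by (intro degree_diff_le) (auto intro: order.trans[OF degree_pCons_le]
        order.trans[OF degree_smult_le])
  moreover have "Suc (card A) \<le> degree (pCons 0 ?F - smult (r k) ?F)"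
    by (rule le_degree) (use calculation in simp)
  ultimately show ?case
    unfolding eq using insert by simp
qed simp

lemma frob_coeff_prod_linear_factors:
  "frob (coeff (\<Prod>k\<in>A. [:- r k, 1:]) n) = coeff (\<Prod>k\<in>A. [:- frob (r k), 1:]) n"
proof (induction A arbitrary: n rule: infinite_finite_induct)
  case (insert k A)
  thus ?case
    by (cases n) (simp_all add: coeff_pCons frob_add frob_uminus frob_mult frob_diff)
qed (simp_all add: coeff_pCons split: nat.split)

lemma power_power_commute: "(a ^ m) ^ n = (a ^ n) ^ m" for a :: "'a::monoid_mult"
  by (simp add: mult.commute flip: power_mult)

lemma power_mod_eq:
  fixes x :: "'a::monoid_mult"
  assumes "x ^ N = 1"
  shows "x ^ (v mod N) = x ^ v"
proof -
  have "x ^ v = x ^ (N * (v div N) + v mod N)"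
    by simp
  also have "\<dots> = x ^ (v mod N)"
    by (simp only: power_add power_mult assms) simp
  finally show ?thesis ..
qed

section \<open>Fourier transform and minimal recurrence of a sequence of odd period\<close>

locale odd_periodic =
  fixes s :: "nat \<Rightarrow> 4" and N :: nat and c :: "'a::field_char_2"
  assumes odd_period: "odd N"
    and periodic: "s (u + N) = s u"
    and root_power: "c ^ N = 1"
    and root_primitive: "\<lbrakk>0 < d; d < N\<rbrakk> \<Longrightarrow> c ^ d \<noteq> 1"
begin

abbreviation S :: "nat \<Rightarrow> 'a witt" where
  "S u \<equiv> of_Z4 (s u)"

definition dft :: "nat \<Rightarrow> 'a witt" where
  "dft k = (\<Sum>u<N. S u * teich c ^ (k * u))"

text \<open>The inversion formula writes the sequence as a combination of geometric progressions;
  this is the ratio of the progression at frequency \<open>k\<close>.\<close>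

abbreviation root :: "nat \<Rightarrow> 'a witt" where
  "root k \<equiv> teich (inverse c) ^ k"

lemma period_pos: "N > 0"
  using odd_period by (rule odd_pos)

lemma c_nonzero: "c \<noteq> 0"
  using root_power period_pos by (auto simp: power_0_left)

lemma teich_inverse: "teich c * teich (inverse c) = 1"
  using c_nonzero by (simp flip: teich_mult)

lemma c_power_inj:
  assumes "c ^ u = c ^ v" "u < N" "v < N"
  shows "u = v"
proof -
  have False if "c ^ u = c ^ v" "u < v" "v < N" for u v
  proof -
    have "c ^ u * c ^ (v - u) = c ^ v"
      using le_add_diff_inverse[of u v] that(2) by (simp only: power_add[symmetric] less_imp_le)
    hence "c ^ u * c ^ (v - u) = c ^ u * 1"
      using that(1) by simp
    hence "c ^ (v - u) = 1"
      using c_nonzero by simp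
    thus False
      using root_primitive[of "v - u"] that by simp
  qed
  thus ?thesis
    using assms by (metis linorder_neq_iff)
qed

lemma s_mod: "s (u mod N) = s u"
proof -
  have "s (v + k * N) = s v" for v k
    by (induction k) (simp_all add: periodic flip: add.assoc[of _ _ N] add: add.commute[of N])
  from this[of "u mod N" "u div N"] show ?thesis
    by simp
qed

lemma teich_c_power: "teich c ^ N = 1"
  using root_power by (simp add: teich_power)

lemma root_power_mod: "root k ^ (v mod N) = root k ^ v"
proof (rule power_mod_eq)
  have "root k ^ N = (teich (inverse (c ^ N))) ^ k"
    unfolding power_power_commute[of _ k N] by (simp add: teich_power power_inverse)
  thus "root k ^ N = 1"
    using root_power by simp
qed

text \<open>Orthogonality: after exchanging the sums, the inner geometric sum vanishes except at the
  index congruent to \<open>v\<close>.\<close>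

lemma dft_inversion: "(\<Sum>k<N. dft k * root k ^ v) = of_nat N * S v"
proof -
  \<comment> \<open>Reduction modulo \<open>N\<close> makes the exponent one of the summation
    indices.\<close>
  define w where "w = v mod N"
  have w: "w < N"
    using period_pos by (simp add: w_def)
  have "teich c ^ (k * u) * root k ^ w = teich (c ^ u * inverse c ^ w) ^ k" for k u
    by (simp only: teich_mult power_mult_distrib teich_power[symmetric] power_mult[symmetric]
        mult.commute[of k])
  hence "(\<Sum>k<N. dft k * root k ^ w) = (\<Sum>k<N. \<Sum>u<N. S u * teich (c ^ u * inverse c ^ w) ^ k)"
    by (simp only: dft_def sum_distrib_right mult.assoc)
  also have "\<dots> = (\<Sum>u<N. S u * (\<Sum>k<N. teich (c ^ u * inverse c ^ w) ^ k))"
    unfolding sum_distrib_left by (rule sum.swap)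
  also have "\<dots> = (\<Sum>u<N. if u = w then of_nat N * S w else 0)"
  proof (rule sum.cong[OF refl])
    fix u assume u: "u \<in> {..<N}"
    show "S u * (\<Sum>k<N. teich (c ^ u * inverse c ^ w) ^ k) = (if u = w then of_nat N * S w else 0)"
    proof (cases "u = w")
      case True
      thus ?thesis
        using c_nonzero by (simp add: power_inverse mult.commute)
    next
      case False
      hence "c ^ u \<noteq> c ^ w"
        using c_power_inj u w by blast
      hence "c ^ u * inverse c ^ w \<noteq> 1"
        using c_nonzero by (simp add: power_inverse field_simps)
      moreover have "(c ^ u * inverse c ^ w) ^ N = (c ^ N) ^ u * (inverse c ^ N) ^ w"
        by (simp only: power_mult_distrib power_power_commute[of c u N]
            power_power_commute[of "inverse c" w N])
      hence "(c ^ u * inverse c ^ w) ^ N = 1"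
        using root_power by (simp add: power_inverse)
      ultimately show ?thesis
        using False by (simp add: sum_teich_power_eq_0)
    qed
  qed
  also have "\<dots> = of_nat N * S w"
    using w by simp
  finally show ?thesis
    by (simp add: w_def root_power_mod s_mod)
qed

text \<open>Transforming the recurrence gives the characteristic polynomial at \<open>root k\<close>
  times \<open>dft k\<close>, which must be 0. As \<open>dft k\<close> may be a zero divisor such as
  2, only the residue of the polynomial value is forced to vanish.\<close>

lemma recurrence_root:
  assumes "satisfies_recurrence s L a" and "dft k \<noteq> 0"
  shows "residue (root k ^ L + (\<Sum>i = 1..L. of_Z4 (a i) * root k ^ (L - i))) = 0"
proof (rule ccontr)
  assume nz: "residue (root k ^ L + (\<Sum>i = 1..L. of_Z4 (a i) * root k ^ (L - i))) \<noteq> 0"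
  define x where "x = teich c ^ k"
  have xy: "x * root k = 1"
    using teich_inverse by (simp add: x_def flip: power_mult_distrib)
  have xN: "x ^ N = 1"
    unfolding x_def power_power_commute[of _ k N] by (simp add: teich_c_power)
  \<comment> \<open>Shifting a sequence by m multiplies its transform by
    \<open>root k ^ m\<close>.\<close>
  have shift: "(\<Sum>u<N. S (u + m) * x ^ u) = root k ^ m * dft k" for m
  proof -
    have "(\<Sum>u<N. S (u + m) * x ^ u) = (\<Sum>u<N. root k ^ m * (S (u + m) * x ^ (u + m)))"
    proof (rule sum.cong[OF refl])
      fix u
      have "root k ^ m * (S (u + m) * x ^ (u + m)) = (x * root k) ^ m * (S (u + m) * x ^ u)"
        by (simp add: power_add power_mult_distrib mult_ac)
      thus "S (u + m) * x ^ u = root k ^ m * (S (u + m) * x ^ (u + m))"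
        by (simp add: xy)
    qed
    also have "\<dots> = root k ^ m * (\<Sum>u<N. S (u + m) * x ^ (u + m))"
      by (simp add: sum_distrib_left)
    also have "(\<Sum>u<N. S (u + m) * x ^ (u + m)) = (\<Sum>u<N. S u * x ^ u)"
      by (rule sum_shift_periodic) (simp add: periodic power_add xN)
    also have "\<dots> = dft k"
      by (simp add: dft_def x_def power_mult)
    finally show ?thesis .
  qed
  have "0 = (\<Sum>u<N. of_Z4 (s (u + L) + (\<Sum>i = 1..L. a i * s (u + L - i))) * x ^ u)"
    using assms(1) by (simp add: satisfies_recurrence_def)
  also have "\<dots> = (\<Sum>u<N. S (u + L) * x ^ u) + (\<Sum>u<N. \<Sum>i = 1..L. of_Z4 (a i) * (S (u + (L - i)) * x ^ u))"
    by (simp add: of_Z4_add of_Z4_sum of_Z4_mult distrib_right sum.distrib sum_distrib_right mult.assoc)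
  also have "\<dots> = (root k ^ L + (\<Sum>i = 1..L. of_Z4 (a i) * root k ^ (L - i))) * dft k"
    by (subst sum.swap)
      (simp only: shift distrib_right sum_distrib_right mult.assoc sum_distrib_left[symmetric])
  finally show False
    using nz assms(2) witt_mult_eq_0D by metis
qed

text \<open>The characteristic polynomial is reduced to the residue field, where a nonzero
  polynomial has at most as many roots as its degree.\<close>

lemma card_le_recurrence_order:
  assumes "satisfies_recurrence s L a"
  shows "card {k. k < N \<and> dft k \<noteq> 0} \<le> L"
proof -
  define f :: "'a poly" where
    "f = monom 1 L + (\<Sum>i = 1..L. monom (residue (of_Z4 (a i) :: 'a witt)) (L - i))"
  have "coeff f L = 1"
    by (simp add: f_def coeff_sum) (auto intro!: sum.neutral)
  hence "f \<noteq> 0"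
    by auto
  have "degree f \<le> L"
    unfolding f_def
    by (intro degree_add_le degree_monom_le degree_sum_le) (auto intro: order.trans[OF degree_monom_le])
  have "(\<lambda>k. inverse c ^ k) ` {k. k < N \<and> dft k \<noteq> 0} \<subseteq> {x. poly f x = 0}"
  proof (clarsimp)
    fix k assume "dft k \<noteq> 0"
    from recurrence_root[OF assms this] show "poly f (inverse c ^ k) = 0"
      by (simp add: f_def poly_sum poly_monom residue_sum)
  qed
  moreover have "inj_on (\<lambda>k. inverse c ^ k) {k. k < N \<and> dft k \<noteq> 0}"
    by (rule inj_onI) (simp add: c_power_inj power_inverse)
  ultimately have "card {k. k < N \<and> dft k \<noteq> 0} \<le> card {x. poly f x = 0}"
    using poly_roots_finite[OF \<open>f \<noteq> 0\<close>] by (intro card_inj_on_le)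
  also have "\<dots> \<le> degree f"
    using \<open>f \<noteq> 0\<close> by (rule card_poly_roots_bound)
  finally show ?thesis
    using \<open>degree f \<le> L\<close> by simp
qed

lemma dft_mod: "dft (k mod N) = dft k"
proof -
  have "teich c ^ (k mod N * u) = teich c ^ (k * u)" for u
    by (simp only: power_mult power_mod_eq[OF teich_c_power])
  thus ?thesis
    by (simp add: dft_def)
qed

text \<open>The values of the sequence are fixed by Frobenius, while the Teichmueller lift of
  \<open>c\<close> is squared.\<close>

lemma frob_dft: "frob (dft k) = dft (2 * k)"
proof -
  have "frob (S u) = S u" for u
    by (simp add: frob_fixed_iff)
  thus ?thesis
    by (simp add: dft_def frob_sum frob_mult teich_power frob_teich ac_simps
        flip: power_mult)
qed

text \<open>The product of the linear factors at the nonzero frequencies is invariant under the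
  Frobenius map, because doubling permutes those frequencies.\<close>

lemma exists_recurrence:
  "\<exists>a. satisfies_recurrence s (card {k. k < N \<and> dft k \<noteq> 0}) a"
proof -
  define A where "A = {k. k < N \<and> dft k \<noteq> 0}"
  define L where "L = card A"
  define F where "F = (\<Prod>k\<in>A. [:- root k, 1:])"
  have [simp]: "finite A"
    by (simp add: A_def)
  have F: "degree F = L" "coeff F L = 1"
    using monic_prod_linear_factors[of A root] by (simp_all add: F_def L_def)
  \<comment> \<open>Doubling is injective modulo \<open>N\<close> because \<open>N\<close> is
    odd.\<close>
  have inj: "inj_on (\<lambda>k. 2 * k mod N) A"
  proof (rule inj_onI)
    fix k l assume "k \<in> A" "l \<in> A" "2 * k mod N = 2 * l mod N"
    hence "[2 * k = 2 * l] (mod N)" "k < N" "l < N"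
      by (simp_all add: cong_def A_def)
    thus "k = l"
      using odd_period cong_less_modulus_unique_nat[of k l N]
      by (simp add: cong_mult_lcancel_nat)
  qed
  have "(\<lambda>k. 2 * k mod N) ` A \<subseteq> A"
    using period_pos by (auto simp: A_def dft_mod simp flip: frob_dft)
  hence double: "bij_betw (\<lambda>k. 2 * k mod N) A A"
    using inj by (simp add: bij_betw_def endo_inj_surj)
  have frob_root: "frob (root k) = root (2 * k mod N)" for k
  proof -
    have "frob (root k) = root 1 ^ (2 * k)"
      by (simp add: teich_power frob_teich mult.commute flip: power_mult)
    thus ?thesis
      using root_power_mod[of 1 "2 * k"] by simp
  qed
  have "frob (coeff F n) = coeff F n" for n
  proof -
    have "(\<Prod>k\<in>A. [:- frob (root k), 1:]) = F"
      unfolding F_def frob_root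
      using prod.reindex_bij_betw[OF double, of "\<lambda>k. [:- root k, 1:]"] .
    thus ?thesis
      by (simp only: F_def frob_coeff_prod_linear_factors)
  qed
  hence "\<exists>z. coeff F n = of_Z4 z" for n
    by (auto simp: frob_fixed_iff)
  then obtain z where z: "\<And>n. coeff F n = of_Z4 (z n)"
    by metis
  \<comment> \<open>Injectivity of \<open>of_Z4\<close> enters through its trivial kernel, applied
    to \<open>z L - 1\<close>.\<close>
  have zL: "z L = 1"
    using F(2) z[of L] of_Z4_eq_0_iff[of "z L - 1"] of_Z4_add[of "z L - 1" 1]
    by (metis add_right_cancel diff_add_cancel add_0 of_Z4_1)
  have vanish: "dft k * poly F (root k) = 0" if "k < N" for k
  proof (cases "k \<in> A")
    case True
    hence "poly F (root k) = 0"
      by (auto simp: F_def poly_prod intro!: prod_zero)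
    thus ?thesis by simp
  next
    case False
    thus ?thesis
      using that by (simp add: A_def)
  qed
  have rec: "(\<Sum>j\<le>L. z j * s (u + j)) = 0" for u
  proof -
    \<comment> \<open>The factor \<open>N\<close> makes the inversion formula applicable. It is a
      unit since \<open>N\<close> is odd, and is cancelled at the end.\<close>
    have "of_nat N * (\<Sum>j\<le>L. coeff F j * S (u + j))
        = (\<Sum>j\<le>L. coeff F j * (\<Sum>k<N. dft k * root k ^ (u + j)))"
      by (simp only: dft_inversion) (simp add: sum_distrib_left mult_ac)
    also have "\<dots> = (\<Sum>k<N. \<Sum>j\<le>L. coeff F j * (dft k * root k ^ (u + j)))"
      unfolding sum_distrib_left by (rule sum.swap)
    also have "\<dots> = (\<Sum>k<N. root k ^ u * (dft k * poly F (root k)))"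
      by (simp add: poly_altdef F(1) sum_distrib_left power_add mult_ac)
    also have "\<dots> = 0"
      by (simp add: vanish)
    finally have *: "of_nat N * (\<Sum>j\<le>L. coeff F j * S (u + j)) = 0" .
    have "residue (of_nat N :: 'a witt) \<noteq> 0"
      using odd_period by (simp add: residue_of_nat of_nat_odd_char_2)
    with * have "(\<Sum>j\<le>L. coeff F j * S (u + j)) = 0"
      by (rule witt_mult_eq_0D)
    hence "of_Z4 (\<Sum>j\<le>L. z j * s (u + j)) = (0 :: 'a witt)"
      by (simp add: z of_Z4_sum of_Z4_mult)
    thus ?thesis
      by simp
  qed
  \<comment> \<open>In a recurrence the i-th coefficient belongs to the shift by
    \<open>L - i\<close>, so the coefficients of \<open>F\<close> appear in reverse order.\<close>
  have "satisfies_recurrence s L (\<lambda>i. z (L - i))"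
    unfolding satisfies_recurrence_def
  proof
    fix u
    have "(\<Sum>i = 1..L. z (L - i) * s (u + L - i)) = (\<Sum>j<L. z j * s (u + j))"
      by (rule sum.reindex_bij_witness[of _ "\<lambda>j. L - j" "\<lambda>i. L - i"]) auto
    thus "s (u + L) + (\<Sum>i = 1..L. z (L - i) * s (u + L - i)) = 0"
      using rec[of u] zL by (simp add: lessThan_Suc_atMost[symmetric] add.commute)
  qed
  thus ?thesis
    unfolding L_def A_def by blast
qed

theorem linear_complexity_eq: "linear_complexity s = card {k. k < N \<and> dft k \<noteq> 0}"
  unfolding linear_complexity_def
  by (rule Least_equality) (use exists_recurrence card_le_recurrence_order in blast)+

end

section \<open>Generalized cyclotomic classes of order four\<close>

text \<open>A zero of 1 + X + ... + X^(r-1) is taken. It is not 1, since the value there is r, which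
  is 1 in characteristic 2 for odd r.\<close>

lemma exists_prime_root_of_unity:
  assumes "prime r" and "odd r"
  shows "\<exists>w :: 'a::{alg_closed_field, field_char_2}. w ^ r = 1 \<and> w \<noteq> 1"
proof -
  have r: "r - 1 > 0" "{..r - 1} = {..<r}"
    using prime_gt_1_nat[OF assms(1)] by auto
  obtain w :: 'a where "(\<Sum>k\<le>r - 1. 1 * w ^ k) = 0"
    using alg_closed[OF r(1), of "\<lambda>_. 1"] by auto
  hence w: "(\<Sum>k<r. w ^ k) = 0"
    by (simp only: r(2) mult_1)
  have "w ^ r - 1 = (w - 1) * (\<Sum>k<r. w ^ k)"
    by (rule power_diff_1_eq)
  hence "w ^ r = 1"
    unfolding w by simp
  moreover have "w \<noteq> 1"
    using w assms(2) by (auto simp: of_nat_odd_char_2)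
  ultimately show ?thesis
    by blast
qed

text \<open>If \<open>r\<close> does not divide \<open>d\<close>, then \<open>d\<close> has an
  inverse x modulo \<open>r\<close>, and \<open>w = (w ^ d) ^ x\<close>.\<close>

lemma prime_root_power_eq_1_iff:
  fixes w :: "'a::field"
  assumes "prime r" and "w ^ r = 1" and "w \<noteq> 1"
  shows "w ^ d = 1 \<longleftrightarrow> r dvd d"
proof
  assume d: "w ^ d = 1"
  show "r dvd d"
  proof (rule ccontr)
    assume "\<not> r dvd d"
    hence "coprime d r"
      using prime_imp_coprime[OF assms(1)] by (simp add: coprime_commute)
    then obtain x where "[d * x = 1] (mod r)"
      using cong_solve_coprime_nat by auto
    hence "w ^ (d * x mod r) = w ^ (1 mod r)"
      by (simp add: cong_def)
    hence "(w ^ d) ^ x = w"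
      by (simp only: power_mod_eq[OF assms(2)] power_mult power_one_right)
    thus False
      using d assms(3) by simp
  qed
qed (use assms(2) in \<open>auto simp: power_mult elim!: dvdE\<close>)

lemma sum_periodic_blocks:
  fixes f :: "nat \<Rightarrow> 'a::comm_ring_1"
  assumes "\<And>u. f (u + M) = f u"
  shows "(\<Sum>u<M * n. f u) = of_nat n * (\<Sum>u<M. f u)"
proof (induction n)
  case (Suc n)
  have "(\<Sum>u<M * Suc n. f u) = (\<Sum>u<M * n. f u) + (\<Sum>u<M. f (u + M * n))"
    using sum.nat_group[of f M 1] sum.atLeastLessThan_concat[of 0 "M * n" "M * n + M" f]
      sum.shift_bounds_nat_ivl[of f 0 "M * n" M]
    by (simp add: atLeast0LessThan add.commute)
  thus ?case
    using Suc sum_shift_periodic[of f M "M * n", OF assms] by (simp add: algebra_simps)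
qed simp

text \<open>The powers of \<open>a\<close> run \<open>n\<close> times through the nonzero residues,
  and each round contributes the full geometric sum 0 minus its term 1.\<close>

lemma sum_primroot_powers:
  assumes "prime r" and "residue_primroot r a" and "y ^ r = 1" and "y \<noteq> 1"
  shows "(\<Sum>s<(r - 1) * n. teich y ^ (a ^ s)) = - of_nat n"
proof -
  have mod_eq: "teich y ^ (u mod r) = teich y ^ u" for u
    by (rule power_mod_eq) (simp add: teich_power assms(3))
  have r: "r > 1"
    using assms(1) by (rule prime_gt_1_nat)
  have [simp]: "totient r = r - 1"
    using assms(1) by (rule totient_prime)
  have "[a ^ (r - 1) = 1] (mod r)"
    using assms(2) euler_theorem[of a r] by (simp add: residue_primroot_def coprime_commute)
  hence "[a ^ (s + (r - 1)) = a ^ s] (mod r)" for s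
    using cong_mult[of "a ^ s" "a ^ s" r "a ^ (r - 1)" 1] by (simp add: power_add)
  hence "teich y ^ (a ^ (s + (r - 1))) = teich y ^ (a ^ s)" for s
    unfolding cong_def by (metis mod_eq)
  hence "(\<Sum>s<(r - 1) * n. teich y ^ (a ^ s)) = of_nat n * (\<Sum>s<r - 1. teich y ^ (a ^ s))"
    by (rule sum_periodic_blocks)
  also have "(\<Sum>s<r - 1. teich y ^ (a ^ s)) = (\<Sum>s<r - 1. teich y ^ (a ^ s mod r))"
    by (simp add: mod_eq)
  also have "\<dots> = (\<Sum>u\<in>totatives r. teich y ^ u)"
    using sum.reindex_bij_betw[OF residue_primroot_is_generator[OF r assms(2)],
        of "\<lambda>u. teich y ^ u"] by simp
  also have "totatives r = {..<r} - {0}"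
    using assms(1) r by (auto simp: totatives_prime)
  also have "(\<Sum>u\<in>{..<r} - {0}. teich y ^ u) = - 1"
    using sum_teich_power_eq_0[OF assms(3,4)] r by (simp add: sum_diff1)
  finally show ?thesis
    by simp
qed

section \<open>Partition of the residues modulo \<open>p * q\<close> into classes\<close>

locale cyclotomic_classes =
  fixes p q a b :: nat
  assumes prime_p: "prime p" and prime_q: "prime q" and distinct: "p \<noteq> q"
    and gcd_eq_4: "gcd (p - 1) (q - 1) = 4"
    and primroot_p: "residue_primroot p a" and primroot_q: "residue_primroot q a"
    and b_mod_p: "[b = a] (mod p)" and b_mod_q: "[b = 1] (mod q)"
begin

abbreviation N :: nat where "N \<equiv> p * q"
abbreviation e :: nat where "e \<equiv> (p - 1) * (q - 1) div 4"

lemma four_dvd: "4 dvd p - 1" "4 dvd q - 1"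
  by (metis gcd_dvd1 gcd_dvd2 gcd_eq_4)+

lemma p_gt_1: "p > 1" and q_gt_1: "q > 1"
  using prime_p prime_q by (blast intro: prime_gt_1_nat)+

lemma p_pos [simp]: "p > 0" and q_pos [simp]: "q > 0"
  using p_gt_1 q_gt_1 by simp_all

lemma p_eq: "p = 4 * ((p - 1) div 4) + 1" and q_eq: "q = 4 * ((q - 1) div 4) + 1"
  using four_dvd p_gt_1 q_gt_1 by simp_all

lemma odd_p: "odd p" and odd_q: "odd q"
  by (subst p_eq, simp) (subst q_eq, simp)

lemma N_gt_1: "N > 1"
  using p_gt_1 q_gt_1 by (rule less_1_mult)

lemma e_eq: "e = (p - 1) * ((q - 1) div 4)" "e = (q - 1) * ((p - 1) div 4)"
  using four_dvd by (simp_all add: div_mult_swap mult.commute)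

lemma add_e_cong: "[s + e = s] (mod (p - 1))" "[s + e = s] (mod (q - 1))"
  unfolding cong_def by (subst e_eq, simp)+

lemma e_lcm: "e = lcm (p - 1) (q - 1)"
  unfolding prod_gcd_lcm_nat[of "p - 1" "q - 1"] gcd_eq_4 by simp

lemma four_dvd_e: "4 dvd e"
  unfolding e_eq(1) using four_dvd(1) by (rule dvd_mult2)

lemma coprime_p_q: "coprime p q"
  using prime_p prime_q distinct by (rule primes_coprime)

lemma cong_N_iff: "[u = v] (mod N) \<longleftrightarrow> [u = v] (mod p) \<and> [u = v] (mod q)" for u v :: nat
  using coprime_cong_mult_nat[OF _ _ coprime_p_q] cong_modulus_mult_nat
  by (metis mult.commute)

lemma N_dvd_iff: "N dvd u \<longleftrightarrow> p dvd u \<and> q dvd u"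
  using cong_N_iff[of u 0] by (simp add: cong_0_iff)

lemma a_power_cong_p: "[a ^ s = a ^ t] (mod p) \<longleftrightarrow> [s = t] (mod (p - 1))"
  and a_power_cong_q: "[a ^ s = a ^ t] (mod q) \<longleftrightarrow> [s = t] (mod (q - 1))"
  using primroot_p primroot_q prime_p prime_q
  by (simp_all add: residue_primroot_def order_divides_expdiff totient_prime)

lemma class_elem_mod_p: "[a ^ s * b ^ i = a ^ (s + i)] (mod p)"
  using cong_mult[OF cong_refl[of "a ^ s"] cong_pow[OF b_mod_p, of i]] by (simp add: power_add)

lemma class_elem_mod_q: "[a ^ s * b ^ i = a ^ s] (mod q)"
  using cong_mult[OF cong_refl[of "a ^ s"] cong_pow[OF b_mod_q, of i]] by simp

text \<open>By the Chinese remainder theorem a class element is given by its discrete logarithms to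
  base \<open>a\<close>: \<open>s + i\<close> modulo \<open>p - 1\<close> and \<open>s\<close>
  modulo \<open>q - 1\<close>.\<close>

lemma class_elem_cong_iff:
  "[a ^ s * b ^ i = a ^ t * b ^ j] (mod N) \<longleftrightarrow>
    [s + i = t + j] (mod (p - 1)) \<and> [s = t] (mod (q - 1))"
  unfolding cong_N_iff a_power_cong_p[symmetric] a_power_cong_q[symmetric]
  by (meson class_elem_mod_p class_elem_mod_q cong_sym cong_trans)

text \<open>The index is the difference of the two discrete logarithms, both of which are meaningful
  modulo 4.\<close>

lemma class_index_cong:
  assumes "[a ^ s * b ^ i = a ^ t * b ^ j] (mod N)"
  shows "[i = j] (mod 4)"
proof -
  have "[s + i = t + j] (mod 4)" "[s = t] (mod 4)"
    using assms four_dvd cong_dvd_modulus_nat unfolding class_elem_cong_iff by blast+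
  hence "[t + i = t + j] (mod 4)"
    by (meson cong_add_rcancel_nat cong_sym cong_trans)
  thus ?thesis
    by (simp only: cong_add_lcancel_nat)
qed

lemma class_elem_unique:
  assumes "[a ^ s * b ^ i = a ^ t * b ^ j] (mod N)" and "i < 4" "j < 4" "s < e" "t < e"
  shows "s = t \<and> i = j"
proof -
  have ij: "i = j"
    using class_index_cong[OF assms(1)] assms(2,3) by (simp add: cong_def)
  hence "[s = t] (mod (p - 1))" "[s = t] (mod (q - 1))"
    using assms(1) unfolding class_elem_cong_iff by (simp_all add: cong_add_rcancel_nat)
  hence "[s = t] (mod e)"
    unfolding e_lcm by (rule cong_cong_lcm_nat)
  thus ?thesis
    using ij assms(4,5) by (simp add: cong_def)
qed

definition units :: "nat set" where
  "units = {u. u < N \<and> \<not> p dvd u \<and> \<not> q dvd u}"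

lemma P_set_iff: "u \<in> P_set p q \<longleftrightarrow> u < N \<and> u \<noteq> 0 \<and> p dvd u"
  using p_gt_1 q_gt_1
  by (auto simp: P_set_def mult.commute[of _ p] less_Suc_eq_le elim!: dvdE intro!: Suc_leI)

lemma Q_set_iff: "u \<in> Q_set p q \<longleftrightarrow> u < N \<and> u \<noteq> 0 \<and> q dvd u"
  using p_gt_1 q_gt_1
  by (auto simp: Q_set_def mult.commute[of _ q] less_Suc_eq_le elim!: dvdE intro!: Suc_leI)

lemma finite_P_set: "finite (P_set p q)" and finite_Q_set: "finite (Q_set p q)"
  and finite_units: "finite units"
  by (rule finite_subset[of _ "{..<N}"]; auto simp: P_set_iff Q_set_iff units_def)+

lemma lessThan_N: "{..<N} = insert 0 (P_set p q \<union> Q_set p q \<union> units)"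
  using N_gt_1 by (auto simp: P_set_iff Q_set_iff units_def)

lemma disjoint_sets:
  "P_set p q \<inter> Q_set p q = {}" "P_set p q \<inter> units = {}" "Q_set p q \<inter> units = {}"
  "0 \<notin> P_set p q" "0 \<notin> Q_set p q" "0 \<notin> units"
proof -
  have "\<not> (p dvd u \<and> q dvd u)" if "u < N" "u \<noteq> 0" for u
    using that N_dvd_iff[of u] nat_dvd_not_less[of u N] by blast
  thus "P_set p q \<inter> Q_set p q = {}"
    unfolding disjoint_iff P_set_iff Q_set_iff by blast
qed (auto simp: P_set_iff Q_set_iff units_def)

lemma sum_lessThan_N:
  fixes f :: "nat \<Rightarrow> 'b::comm_monoid_add"
  shows "(\<Sum>u<N. f u) = f 0 + (sum f (P_set p q) + sum f (Q_set p q) + sum f units)"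
  unfolding lessThan_N using disjoint_sets finite_P_set finite_Q_set finite_units
  by (simp add: sum.union_disjoint Int_Un_distrib2)

text \<open>Including the term at 0 yields a sum over all multiples of \<open>q\<close>, to which
  the geometric sum formula applies.\<close>

lemma sum_Q_set: "f 0 + sum f (Q_set p q) = (\<Sum>j<p. f (j * q))"
  for f :: "nat \<Rightarrow> 'b::comm_monoid_add"
proof -
  have "{1..<p} = {k. 1 \<le> k \<and> k \<le> p - 1}"
    by auto
  hence "Q_set p q = (\<lambda>j. j * q) ` {1..<p}"
    by (simp only: Q_set_def setcompr_eq_image)
  moreover have "inj_on (\<lambda>j. j * q) {1..<p}"
    using q_gt_1 by (auto simp: inj_on_def)
  moreover have "{..<p} = insert 0 {1..<p}"
    using p_gt_1 by auto
  ultimately show ?thesis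
    by (simp add: sum.reindex)
qed

lemma sum_P_set: "f 0 + sum f (P_set p q) = (\<Sum>j<q. f (j * p))"
  for f :: "nat \<Rightarrow> 'b::comm_monoid_add"
proof -
  have "{1..<q} = {k. 1 \<le> k \<and> k \<le> q - 1}"
    by auto
  hence "P_set p q = (\<lambda>j. j * p) ` {1..<q}"
    by (simp only: P_set_def setcompr_eq_image)
  moreover have "inj_on (\<lambda>j. j * p) {1..<q}"
    using p_gt_1 by (auto simp: inj_on_def)
  moreover have "{..<q} = insert 0 {1..<q}"
    using q_gt_1 by auto
  ultimately show ?thesis
    by (simp add: sum.reindex)
qed

lemma card_P_set: "card (P_set p q) = q - 1" and card_Q_set: "card (Q_set p q) = p - 1"
  using sum_P_set[of "\<lambda>_. 1 :: nat"] sum_Q_set[of "\<lambda>_. 1 :: nat"] by simp_all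

lemma card_units: "card units = 4 * e"
proof -
  have "N = 1 + ((q - 1) + (p - 1) + card units)"
    using sum_lessThan_N[of "\<lambda>_. 1 :: nat"] by (simp add: card_P_set card_Q_set)
  moreover have "N = (p - 1) * (q - 1) + 1 + ((q - 1) + (p - 1))"
    using p_gt_1 q_gt_1 by (cases p; cases q) auto
  moreover have "4 * e = (p - 1) * (q - 1)"
    using four_dvd by simp
  ultimately show ?thesis
    by linarith
qed

lemma class_elem_not_dvd: "\<not> p dvd a ^ s * b ^ i" "\<not> q dvd a ^ s * b ^ i"
proof -
  have "\<not> p dvd a" "\<not> q dvd a"
    using primroot_p primroot_q p_gt_1 q_gt_1
    by (auto simp: residue_primroot_def coprime_def)
  thus "\<not> p dvd a ^ s * b ^ i" "\<not> q dvd a ^ s * b ^ i"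
    using cong_dvd_iff[OF class_elem_mod_p[of s i]] cong_dvd_iff[OF class_elem_mod_q[of s i]]
      prime_p prime_q prime_dvd_power by blast+
qed

text \<open>Surjectivity comes by counting: the map is injective, and both sides have
  \<open>4 * e\<close> elements.\<close>

lemma bij_class_elem:
  "bij_betw (\<lambda>(s, i). a ^ s * b ^ i mod N) ({..<e} \<times> {..<4}) units"
proof (rule bij_betw_imageI)
  show inj: "inj_on (\<lambda>(s, i). a ^ s * b ^ i mod N) ({..<e} \<times> {..<4})"
  proof (rule inj_onI)
    fix u v assume uv: "u \<in> {..<e} \<times> {..<4}" "v \<in> {..<e} \<times> {..<4}"
      and eq: "(\<lambda>(s, i). a ^ s * b ^ i mod N) u = (\<lambda>(s, i). a ^ s * b ^ i mod N) v"
    have "[a ^ fst u * b ^ snd u = a ^ fst v * b ^ snd v] (mod N)"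
      using eq unfolding cong_def split_beta .
    from class_elem_unique[OF this] show "u = v"
      using uv by (simp add: mem_Times_iff prod_eq_iff)
  qed
  show "(\<lambda>(s, i). a ^ s * b ^ i mod N) ` ({..<e} \<times> {..<4}) = units"
  proof (rule card_subset_eq[OF finite_units])
    show "(\<lambda>(s, i). a ^ s * b ^ i mod N) ` ({..<e} \<times> {..<4}) \<subseteq> units"
    proof clarify
      fix s i
      show "a ^ s * b ^ i mod N \<in> units"
        using class_elem_not_dvd[of s i] N_gt_1 by (simp add: units_def dvd_mod_iff)
    qed
    show "card ((\<lambda>(s, i). a ^ s * b ^ i mod N) ` ({..<e} \<times> {..<4})) = card units"
      by (simp only: card_image[OF inj] card_units card_cartesian_product card_lessThan
          mult.commute[of _ 4])
  qed
qed

lemma sum_units: "sum f units = (\<Sum>i<4. \<Sum>s<e. f (a ^ s * b ^ i mod N))"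
  for f :: "nat \<Rightarrow> 'b::comm_monoid_add"
  using sum.reindex_bij_betw[OF bij_class_elem, of f]
  by (subst sum.swap) (simp add: sum.cartesian_product case_prod_unfold)

text \<open>The unit \<open>b ^ 4\<close> lies in some class, and its index is congruent to 4, hence
  0, modulo 4.\<close>

lemma b_power_4: "\<exists>t. [b ^ 4 = a ^ t] (mod N)"
proof -
  have "b ^ 4 mod N \<in> units"
    using class_elem_not_dvd[of 0 4] N_gt_1 by (simp add: units_def dvd_mod_iff)
  then obtain s i where si: "i < 4" "b ^ 4 mod N = a ^ s * b ^ i mod N"
    unfolding bij_betw_imp_surj_on[OF bij_class_elem, symmetric] by auto
  hence cong: "[a ^ 0 * b ^ 4 = a ^ s * b ^ i] (mod N)"
    by (simp add: cong_def)
  hence "i = 0"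
    using class_index_cong[OF cong] si(1) by (simp add: cong_def)
  thus ?thesis
    using cong by auto
qed

section \<open>Gauss periods and their weighted sum\<close>

definition gauss_period :: "nat \<Rightarrow> 'r \<Rightarrow> 'r::comm_ring_1" where
  "gauss_period i x = (\<Sum>s<e. x ^ (a ^ s * b ^ i))"

text \<open>For \<open>x\<close> an \<open>N\<close>-th root of unity this is what the four classes
  contribute to the transform of the sequence.\<close>

definition class_sum :: "'r \<Rightarrow> 'r::comm_ring_1" where
  "class_sum x = (\<Sum>i<4. of_nat i * gauss_period i x)"

lemma class_sum_eq: "class_sum x = gauss_period 1 x + 2 * gauss_period 2 x + 3 * gauss_period 3 x"
  by (simp add: class_sum_def numeral_eq_Suc)

lemma power_cong_N: "x ^ N = 1 \<Longrightarrow> [u = v] (mod N) \<Longrightarrow> x ^ u = x ^ v" for x :: "'r::comm_ring_1"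
  unfolding cong_def by (metis power_mod_eq)

text \<open>Raising to the power \<open>a ^ t\<close> translates the index \<open>s\<close> by
  \<open>t\<close>, and the summand has period \<open>e\<close> in \<open>s\<close>.\<close>

lemma gauss_period_shift:
  fixes x :: "'r::comm_ring_1"
  assumes "x ^ N = 1"
  shows "gauss_period i (x ^ (a ^ t)) = gauss_period i x"
proof -
  have "[a ^ (s + e) * b ^ i = a ^ s * b ^ i] (mod N)" for s
    unfolding class_elem_cong_iff using cong_add[OF add_e_cong(1) cong_refl] add_e_cong(2) by blast
  hence "(\<Sum>s<e. x ^ (a ^ (s + t) * b ^ i)) = (\<Sum>s<e. x ^ (a ^ s * b ^ i))"
    using assms by (intro sum_shift_periodic power_cong_N)
  thus ?thesis
    by (simp add: gauss_period_def power_add mult_ac flip: power_mult)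
qed

lemma gauss_period_Suc: "gauss_period i (x ^ b) = gauss_period (Suc i) x"
  by (simp add: gauss_period_def mult_ac flip: power_mult)

lemma gauss_period_4:
  fixes x :: "'r::comm_ring_1"
  assumes "x ^ N = 1"
  shows "gauss_period 4 x = gauss_period 0 x"
proof -
  obtain t where t: "[b ^ 4 = a ^ t] (mod N)"
    using b_power_4 ..
  have "gauss_period 4 x = gauss_period 0 (x ^ (b ^ 4))"
    by (simp add: gauss_period_def mult_ac flip: power_mult)
  also have "x ^ (b ^ 4) = x ^ (a ^ t)"
    using assms t by (rule power_cong_N)
  finally show ?thesis
    using gauss_period_shift[OF assms] by simp
qed

text \<open>The weights add up to 0 + 1 + 2 + 3 = 6, which is 2 modulo 4.\<close>

lemma class_sum_const:
  fixes x :: "'a::field_char_2 witt"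
  assumes "\<And>i. gauss_period i x = w"
  shows "class_sum x = 2 * w"
proof -
  have "class_sum x = 4 * w + 2 * w"
    by (simp add: class_sum_eq assms algebra_simps)
  thus ?thesis
    by (simp add: witt_4_eq_0)
qed

text \<open>Modulo \<open>p\<close> every class becomes a run of \<open>e\<close> consecutive powers
  of \<open>a\<close>, covering each nonzero residue \<open>(q - 1) div 4\<close> times.\<close>

lemma class_sum_order_p:
  assumes "y ^ p = 1" and "y \<noteq> 1"
  shows "class_sum (teich y) = - (2 * of_nat ((q - 1) div 4))"
proof -
  have per: "teich y ^ p = 1"
    using assms(1) by (simp add: teich_power)
  have "gauss_period i (teich y) = - of_nat ((q - 1) div 4)" for i
  proof -
    have "teich y ^ (a ^ s * b ^ i) = (teich y) ^ (a ^ (s + i))" for s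
      using class_elem_mod_p[of s i] per unfolding cong_def by (metis power_mod_eq)
    moreover have "teich y ^ (a ^ (s + e)) = teich y ^ (a ^ s)" for s
    proof -
      have "[a ^ (s + e) = a ^ s] (mod p)"
        unfolding a_power_cong_p by (rule add_e_cong)
      thus ?thesis
        using per unfolding cong_def by (metis power_mod_eq)
    qed
    ultimately have "gauss_period i (teich y) = (\<Sum>s<e. teich y ^ (a ^ s))"
      unfolding gauss_period_def using sum_shift_periodic[of "\<lambda>s. teich y ^ (a ^ s)" e i] by simp
    thus ?thesis
      using sum_primroot_powers[OF prime_p primroot_p assms] by (simp only: e_eq(1))
  qed
  from class_sum_const[OF this] show ?thesis
    by simp
qed

lemma class_sum_order_q:
  assumes "y ^ q = 1" and "y \<noteq> 1"
  shows "class_sum (teich y) = - (2 * of_nat ((p - 1) div 4))"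
proof -
  have per: "teich y ^ q = 1"
    using assms(1) by (simp add: teich_power)
  have "gauss_period i (teich y) = - of_nat ((p - 1) div 4)" for i
  proof -
    have "teich y ^ (a ^ s * b ^ i) = teich y ^ (a ^ s)" for s
      using class_elem_mod_q[of s i] per unfolding cong_def by (metis power_mod_eq)
    thus ?thesis
      unfolding gauss_period_def
      using sum_primroot_powers[OF prime_q primroot_q assms] by (simp only: e_eq(2))
  qed
  from class_sum_const[OF this] show ?thesis
    by simp
qed

lemma class_sum_1: "class_sum (1 :: 'a::field_char_2 witt) = 0"
proof -
  have "gauss_period i (1 :: 'a witt) = 0" for i
    using four_dvd_e of_nat_witt_eq_0_iff[of e] by (simp only: gauss_period_def) simp
  from class_sum_const[OF this] show ?thesis
    by simp
qed

text \<open>Inclusion and exclusion: the sums over all residues, over the multiples of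
  \<open>q\<close> and over those of \<open>p\<close> vanish, and the term 1 at 0 has been removed
  twice.\<close>

lemma sum_gauss_periods:
  fixes y :: "'a::field_char_2"
  assumes "y ^ N = 1" and "y ^ p \<noteq> 1" and "y ^ q \<noteq> 1"
  shows "(\<Sum>i<4. gauss_period i (teich y)) = 1"
proof -
  let ?f = "\<lambda>u. teich y ^ u"
  have per: "teich y ^ N = 1"
    using assms(1) by (simp add: teich_power)
  have "y \<noteq> 1"
    using assms(2) by auto
  hence "(\<Sum>u<N. ?f u) = 0"
    using assms(1) by (rule sum_teich_power_eq_0[rotated])
  moreover have "?f 0 + sum ?f (Q_set p q) = 0"
  proof -
    have "?f (j * q) = teich (y ^ q) ^ j" for j
      by (simp add: teich_power mult.commute flip: power_mult)
    thus ?thesis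
      unfolding sum_Q_set using assms by (simp add: sum_teich_power_eq_0 mult.commute flip: power_mult)
  qed
  moreover have "?f 0 + sum ?f (P_set p q) = 0"
  proof -
    have "?f (j * p) = teich (y ^ p) ^ j" for j
      by (simp add: teich_power mult.commute flip: power_mult)
    thus ?thesis
      unfolding sum_P_set using assms by (simp add: sum_teich_power_eq_0 mult.commute flip: power_mult)
  qed
  moreover have "sum ?f units = (\<Sum>i<4. gauss_period i (teich y))"
    by (simp add: sum_units gauss_period_def power_mod_eq[OF per])
  moreover have "U = (z + (P + Q + U)) - (z + Q) - (z + P) + z" for z P Q U :: "'a witt"
    by (simp add: algebra_simps)
  ultimately have "(\<Sum>i<4. gauss_period i (teich y)) = 0 - 0 - 0 + ?f 0"
    using sum_lessThan_N[of ?f] by metis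
  thus ?thesis
    by simp
qed

text \<open>Raising to the power \<open>b\<close> moves the periods cyclically, so each weight drops
  by 1 modulo 4 and the sum of all periods, which is 1, is subtracted. Powers of \<open>a\<close>
  change nothing.\<close>

lemma class_sum_class_elem:
  assumes "y ^ N = 1"
    and prim: "\<And>s i. y ^ (a ^ s * b ^ i * p) \<noteq> 1" "\<And>s i. y ^ (a ^ s * b ^ i * q) \<noteq> 1"
  shows "class_sum (teich y ^ (a ^ s * b ^ i)) = class_sum (teich y) - of_nat i"
proof -
  have step: "class_sum (teich z ^ b) = class_sum (teich z) - 1"
    if z: "z ^ N = 1" "z ^ p \<noteq> 1" "z ^ q \<noteq> 1" for z
  proof -
    have per: "teich z ^ N = 1"
      using z(1) by (simp add: teich_power)
    let ?g = "\<lambda>i. gauss_period i (teich z)"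
    have "class_sum (teich z ^ b) = ?g 2 + 2 * ?g 3 + 3 * ?g 4"
      by (simp add: class_sum_eq gauss_period_Suc numeral_eq_Suc)
    also have "\<dots> = ?g 2 + 2 * ?g 3 + 3 * ?g 0"
      by (simp add: gauss_period_4[OF per])
    also have "\<dots> = class_sum (teich z) - (\<Sum>i<4. ?g i) + 4 * ?g 0"
      by (simp add: class_sum_eq numeral_eq_Suc algebra_simps)
    finally show ?thesis
      using sum_gauss_periods[OF z] by (simp add: witt_4_eq_0)
  qed
  have "class_sum (teich y ^ (a ^ s * b ^ i)) = class_sum (teich y ^ (b ^ i))"
  proof -
    have "(teich y ^ (b ^ i)) ^ N = 1"
      using assms(1) power_power_commute[of y "b ^ i" N] by (simp add: teich_power)
    from gauss_period_shift[OF this, of _ s] show ?thesis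
      by (simp add: class_sum_def mult.commute flip: power_mult)
  qed
  also have "\<dots> = class_sum (teich y) - of_nat i"
  proof (induction i)
    case (Suc i)
    have "(y ^ b ^ i) ^ N = 1"
      using assms(1) power_power_commute[of y "b ^ i" N] by simp
    moreover have "(y ^ b ^ i) ^ p \<noteq> 1" "(y ^ b ^ i) ^ q \<noteq> 1"
      using prim[of 0 i] by (simp_all flip: power_mult)
    ultimately have "class_sum (teich (y ^ b ^ i) ^ b) = class_sum (teich (y ^ b ^ i)) - 1"
      by (rule step)
    thus ?case
      using Suc by (simp add: algebra_simps flip: teich_power power_mult)
  qed simp
  finally show ?thesis .
qed

end

section \<open>The transform of the quaternary sequence\<close>

locale quaternary_sequence = cyclotomic_classes +
  fixes g h :: int and c :: "'a::field_char_2"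
  assumes a_cong: "[int a = g] (mod int (p * q))" and b_cong: "[int b = h] (mod int (p * q))"
    and c_power: "c ^ (p * q) = 1"
    and c_primitive: "\<lbrakk>0 < d; d < p * q\<rbrakk> \<Longrightarrow> c ^ d \<noteq> 1"
begin

lemma cyc_class_eq: "cyc_class p q g h i = {a ^ s * b ^ i mod N | s. s < e}"
proof -
  have "nat ((g ^ s * h ^ i) mod int N) = a ^ s * b ^ i mod N" for s
  proof -
    have "[int (a ^ s * b ^ i) = g ^ s * h ^ i] (mod int N)"
      using cong_mult[OF cong_pow[OF a_cong, of s] cong_pow[OF b_cong, of i]] by simp
    hence "(g ^ s * h ^ i) mod int N = int (a ^ s * b ^ i mod N)"
      by (simp only: cong_def of_nat_mod)
    thus ?thesis
      by (simp only: nat_int)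
  qed
  thus ?thesis
    by (simp only: cyc_class_def)
qed

lemma quat_seq_class_elem:
  assumes "s < e" and "i < 4"
  shows "quat_seq p q g h (a ^ s * b ^ i mod N) = of_nat i"
proof -
  let ?v = "a ^ s * b ^ i mod N"
  have "?v \<in> units"
    using class_elem_not_dvd[of s i] by (simp add: units_def dvd_mod_iff)
  hence "?v \<notin> Q_set p q \<union> R_set" "?v \<notin> P_set p q"
    using disjoint_sets by (auto simp: R_set_def)
  moreover have "(THE i. i < 4 \<and> ?v \<in> cyc_class p q g h i) = i"
  proof (rule the_equality)
    show "i < 4 \<and> ?v \<in> cyc_class p q g h i"
      using assms by (auto simp: cyc_class_eq)
  next
    fix j assume "j < 4 \<and> ?v \<in> cyc_class p q g h j"
    then obtain t where "j < 4" "t < e" "[a ^ s * b ^ i = a ^ t * b ^ j] (mod N)"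
      by (auto simp: cyc_class_eq cong_def)
    thus "j = i"
      using class_elem_unique assms by blast
  qed
  ultimately show ?thesis
    by (simp only: quat_seq_def mod_mod_trivial Let_def if_False)
qed

lemma quat_seq_Q_set: "u \<in> insert 0 (Q_set p q) \<Longrightarrow> quat_seq p q g h u = 2"
  by (auto simp: quat_seq_def R_set_def Q_set_iff)

lemma quat_seq_P_set: "u \<in> P_set p q \<Longrightarrow> quat_seq p q g h u = 0"
  using disjoint_sets by (auto simp: quat_seq_def R_set_def P_set_iff disjoint_iff)

sublocale odd_periodic "quat_seq p q g h" N c
proof
  show "odd N"
    using odd_p odd_q by simp
  show "quat_seq p q g h (u + N) = quat_seq p q g h u" for u
    by (simp add: quat_seq_def)
qed (use c_power c_primitive in auto)

lemma c_power_eq_1_iff: "c ^ d = 1 \<longleftrightarrow> N dvd d"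
proof -
  have "c ^ d = c ^ (d mod N)"
    by (simp only: power_mod_eq[OF c_power])
  thus ?thesis
    using c_primitive[of "d mod N"] by (cases "d mod N = 0") (auto simp: dvd_eq_mod_eq_0)
qed

lemma dft_eq:
  "dft k = 2 * (\<Sum>j<p. teich (c ^ (k * q)) ^ j) + class_sum (teich (c ^ k))"
proof -
  let ?f = "\<lambda>u. S u * teich (c ^ k) ^ u"
  have per: "teich (c ^ k) ^ N = 1"
    using power_power_commute[of c k N] c_power by (simp add: teich_power)
  have "dft k = sum ?f {..<N}"
    unfolding dft_def by (simp only: power_mult teich_power)
  also have "\<dots> = (?f 0 + sum ?f (Q_set p q)) + sum ?f (P_set p q) + sum ?f units"
    unfolding sum_lessThan_N by (simp only: ac_simps)
  also have "?f 0 + sum ?f (Q_set p q) = (\<Sum>j<p. ?f (j * q))"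
    by (rule sum_Q_set)
  also have "\<dots> = (\<Sum>j<p. 2 * teich (c ^ (k * q)) ^ j)"
  proof (rule sum.cong[OF refl])
    fix j assume "j \<in> {..<p}"
    hence "j * q \<in> insert 0 (Q_set p q)"
      by (auto simp: Q_set_iff)
    moreover have "teich (c ^ k) ^ (j * q) = teich (c ^ (k * q)) ^ j"
      by (simp only: teich_power power_mult[symmetric] ac_simps)
    ultimately show "?f (j * q) = 2 * teich (c ^ (k * q)) ^ j"
      by (simp only: quat_seq_Q_set of_Z4_2)
  qed
  also have "sum ?f (P_set p q) = 0"
    by (rule sum.neutral) (simp add: quat_seq_P_set)
  also have "sum ?f units = (\<Sum>i<4. \<Sum>s<e. of_nat i * teich (c ^ k) ^ (a ^ s * b ^ i))"
    unfolding sum_units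
    by (intro sum.cong refl) (simp only: lessThan_iff quat_seq_class_elem of_Z4_of_nat power_mod_eq[OF per])
  also have "\<dots> = class_sum (teich (c ^ k))"
    by (simp only: class_sum_def gauss_period_def sum_distrib_left)
  finally show ?thesis
    by (simp add: sum_distrib_left)
qed

lemma of_nat_p: "(of_nat p :: 'a witt) = 1"
  by (subst p_eq) (simp add: witt_4_eq_0)

lemma two_of_nat_eq_0_iff: "2 * of_nat m = (0 :: 'a witt) \<longleftrightarrow> even m"
proof -
  have "2 * of_nat m = (of_nat (2 * m) :: 'a witt)"
    by simp
  moreover have "4 dvd 2 * m \<longleftrightarrow> even m"
    by presburger
  ultimately show ?thesis
    by (simp only: of_nat_witt_eq_0_iff)
qed

lemma two_witt_neq_0: "(2 :: 'a witt) \<noteq> 0"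
  using two_of_nat_eq_0_iff[of 1] by simp

lemma dft_0: "dft 0 \<noteq> 0"
  unfolding dft_eq using two_witt_neq_0 by (simp add: class_sum_1 of_nat_p)

text \<open>Here \<open>c ^ (k * q)\<close> is a nontrivial \<open>p\<close>-th root of unity, so
  the contribution of the multiples of \<open>q\<close> vanishes.\<close>

lemma not_p_dvd_dft:
  assumes "\<not> p dvd k"
  shows "dft k = class_sum (teich (c ^ k))"
proof -
  have "c ^ (k * q) \<noteq> 1"
    unfolding c_power_eq_1_iff using assms by simp
  moreover have "(c ^ (k * q)) ^ p = 1"
    unfolding power_mult[symmetric] c_power_eq_1_iff by (simp add: ac_simps)
  ultimately show ?thesis
    by (simp add: dft_eq sum_teich_power_eq_0)
qed

lemma dft_Q_set:
  assumes "k \<in> Q_set p q"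
  shows "dft k \<noteq> 0 \<longleftrightarrow> odd ((q - 1) div 4)"
proof -
  have k: "q dvd k" "\<not> p dvd k"
    using assms disjoint_sets(1) by (auto simp: Q_set_iff P_set_iff disjoint_iff)
  hence "(c ^ k) ^ p = 1" "c ^ k \<noteq> 1"
    unfolding power_mult[symmetric] c_power_eq_1_iff N_dvd_iff by auto
  from class_sum_order_p[OF this] show ?thesis
    using k by (simp add: not_p_dvd_dft two_of_nat_eq_0_iff)
qed

text \<open>The geometric sum has all terms 1 and equals p, which is 1 modulo 4, so it adds 2 to the
  class sum of a root of order \<open>q\<close>.\<close>

lemma dft_P_set:
  assumes "k \<in> P_set p q"
  shows "dft k \<noteq> 0 \<longleftrightarrow> even ((p - 1) div 4)"
proof -
  let ?m = "(p - 1) div 4"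
  have k: "p dvd k" "\<not> q dvd k"
    using assms disjoint_sets(1) by (auto simp: Q_set_iff P_set_iff disjoint_iff)
  hence "(c ^ k) ^ q = 1" "c ^ k \<noteq> 1"
    unfolding power_mult[symmetric] c_power_eq_1_iff N_dvd_iff by auto
  note class_sum = class_sum_order_q[OF this]
  have "c ^ (k * q) = 1"
    unfolding c_power_eq_1_iff N_dvd_iff using k by simp
  hence "dft k = 2 + - (2 * of_nat ?m)"
    by (simp only: dft_eq class_sum) (simp add: of_nat_p)
  \<comment> \<open>The sign is changed modulo 4, to reach twice a natural number.\<close>
  also have "\<dots> = 2 * of_nat (?m + 1) - 4 * of_nat ?m"
    by (simp add: algebra_simps)
  also have "\<dots> = 2 * of_nat (?m + 1)"
    by (simp only: witt_4_eq_0) simp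
  finally show ?thesis
    by (simp only: two_of_nat_eq_0_iff) simp
qed

lemma dft_class_elem: "dft (a ^ s * b ^ i mod N) = class_sum (teich c) - of_nat i"
proof -
  have "dft (a ^ s * b ^ i mod N) = class_sum (teich c ^ (a ^ s * b ^ i))"
    unfolding dft_mod using class_elem_not_dvd by (simp add: not_p_dvd_dft teich_power)
  also have "\<dots> = class_sum (teich c) - of_nat i"
  proof (rule class_sum_class_elem)
    show "c ^ N = 1"
      by (rule c_power)
    show "c ^ (a ^ s * b ^ i * p) \<noteq> 1" "c ^ (a ^ s * b ^ i * q) \<noteq> 1" for s i
      unfolding c_power_eq_1_iff using class_elem_not_dvd[of s i] by (simp_all add: mult.commute[of p])
  qed
  finally show ?thesis .
qed

lemma linear_complexity_quat_seq:
  "linear_complexity (quat_seq p q g h) \<in>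
     (\<lambda>n. 1 + (if even ((p - 1) div 4) then q - 1 else 0) +
        (if odd ((q - 1) div 4) then p - 1 else 0) + n) ` {4 * e, 3 * e}"
proof -
  \<comment> \<open>Counting by summands 0 and 1 lets the partition of the residues be
    applied.\<close>
  let ?f = "\<lambda>k. if dft k \<noteq> 0 then 1 else 0 :: nat"
  have "sum ?f {..<N} = card ({..<N} \<inter> {k. dft k \<noteq> 0})"
    by (subst sum.If_cases) simp_all
  also have "{..<N} \<inter> {k. dft k \<noteq> 0} = {k. k < N \<and> dft k \<noteq> 0}"
    by blast
  finally have "linear_complexity (quat_seq p q g h) = sum ?f {..<N}"
    unfolding linear_complexity_eq ..
  also have "\<dots> = 1 + (if even ((p - 1) div 4) then q - 1 else 0) +
        (if odd ((q - 1) div 4) then p - 1 else 0) + sum ?f units"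
  proof -
    have "sum ?f (P_set p q) = (\<Sum>k\<in>P_set p q. if even ((p - 1) div 4) then 1 else 0)"
      by (intro sum.cong refl) (simp only: dft_P_set)
    hence "sum ?f (P_set p q) = (if even ((p - 1) div 4) then q - 1 else 0)"
      by (simp add: card_P_set)
    moreover have "sum ?f (Q_set p q) = (\<Sum>k\<in>Q_set p q. if odd ((q - 1) div 4) then 1 else 0)"
      by (intro sum.cong refl) (simp only: dft_Q_set)
    hence "sum ?f (Q_set p q) = (if odd ((q - 1) div 4) then p - 1 else 0)"
      by (simp add: card_Q_set)
    moreover have "?f 0 = 1"
      using dft_0 by simp
    ultimately show ?thesis
      unfolding sum_lessThan_N by (simp only: ac_simps)
  qed
  moreover have "sum ?f units \<in> {4 * e, 3 * e}"
  proof -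
    let ?T = "class_sum (teich c)"
    have "sum ?f units = (\<Sum>i<4. \<Sum>s<e. if ?T - of_nat i \<noteq> 0 then 1 else 0)"
      unfolding sum_units dft_class_elem ..
    also have "\<dots> = (\<Sum>i\<in>{0, 1, 2, 3}. if ?T = of_nat i then 0 else e)"
      by (rule sum.cong) auto
    finally have *: "sum ?f units = (\<Sum>i\<in>{0, 1, 2, 3}. if ?T = of_nat i then 0 else e)" .
    show ?thesis
    \<comment> \<open>The four constants are distinct. If \<open>?T\<close> is none of them, all
      classes count; otherwise exactly one class is lost.\<close>
    proof (cases "\<exists>i\<in>{0, 1, 2, 3}. ?T = of_nat i")
      case False
      thus ?thesis
        unfolding * by simp
    next
      case True
      thus ?thesis
        unfolding *
        by (elim bexE insertE emptyE)
          (simp_all add: zero_witt_def one_witt_def witt_2_eq witt_3_eq plus_witt_def)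
    qed
  qed
  ultimately show ?thesis
    by (simp only: image_eqI)
qed

end

section \<open>A root of unity of order \<open>p * q\<close> and the conclusion\<close>

lemma primitive_root_of_unity_exists:
  assumes "prime p" "odd p" "prime q" "odd q" "p \<noteq> q"
  obtains c :: "'a::{alg_closed_field, field_char_2}"
  where "\<And>d. c ^ d = 1 \<longleftrightarrow> p * q dvd d"
proof -
  obtain v :: 'a where v: "v ^ p = 1" "v \<noteq> 1"
    using exists_prime_root_of_unity assms(1,2) by blast
  obtain w :: 'a where w: "w ^ q = 1" "w \<noteq> 1"
    using exists_prime_root_of_unity assms(3,4) by blast
  note v_iff = prime_root_power_eq_1_iff[OF assms(1) v]
  note w_iff = prime_root_power_eq_1_iff[OF assms(3) w]
  have coprime: "coprime p q"
    using assms by (simp add: primes_coprime)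
  have "(v * w) ^ d = 1 \<longleftrightarrow> p * q dvd d" for d
  proof
    assume d: "(v * w) ^ d = 1"
    \<comment> \<open>Raising further to the power \<open>q\<close> eliminates \<open>w\<close>, and
      to the power \<open>p\<close> eliminates \<open>v\<close>.\<close>
    have "(v * w) ^ (d * q) = 1" "(v * w) ^ (d * p) = 1"
      using d by (simp_all only: power_mult power_one)
    moreover have "w ^ (d * q) = 1" "v ^ (d * p) = 1"
      by (simp_all add: v_iff w_iff)
    ultimately have "p dvd d * q" "q dvd d * p"
      by (simp_all add: power_mult_distrib v_iff w_iff)
    hence "p dvd d" "q dvd d"
      using coprime by (simp_all add: coprime_dvd_mult_left_iff coprime_commute)
    thus "p * q dvd d"
      using coprime by (simp add: divides_mult)
  next
    assume "p * q dvd d"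
    hence "v ^ d = 1" "w ^ d = 1"
      by (auto simp: v_iff w_iff dest: dvd_mult_left dvd_mult_right)
    thus "(v * w) ^ d = 1"
      by (simp add: power_mult_distrib)
  qed
  thus thesis
    by (rule that)
qed

theorem theorem4:
  fixes p q :: nat and g h :: int
  assumes "prime p" and "prime q" and "p \<noteq> q"
    and "gcd (p - 1) (q - 1) = 4"
    and "int_primroot p g" and "int_primroot q g"
    and "[h = g] (mod int p)" and "[h = 1] (mod int q)"
  shows
    "([p = 5] (mod 8) \<and> [q = 5] (mod 8) \<longrightarrow>
        linear_complexity (quat_seq p q g h) = p + (p - 1) * (q - 1) \<or>
        linear_complexity (quat_seq p q g h)
          = p + (p - 1) * (q - 1) - (p - 1) * (q - 1) div 4) \<and>
     ([p = 1] (mod 8) \<and> [q = 5] (mod 8) \<longrightarrow>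
        linear_complexity (quat_seq p q g h) = p + q - 1 + (p - 1) * (q - 1) \<or>
        linear_complexity (quat_seq p q g h)
          = p + q - 1 + (p - 1) * (q - 1) - (p - 1) * (q - 1) div 4) \<and>
     ([p = 5] (mod 8) \<and> [q = 1] (mod 8) \<longrightarrow>
        linear_complexity (quat_seq p q g h) = 1 + (p - 1) * (q - 1) \<or>
        linear_complexity (quat_seq p q g h)
          = 1 + (p - 1) * (q - 1) - (p - 1) * (q - 1) div 4)"
proof -
  \<comment> \<open>Natural representatives are chosen so that they can serve in exponents; reducing
    them modulo \<open>p\<close> or \<open>q\<close> recovers the residues judged by
    \<open>int_primroot\<close>.\<close>
  define a where "a = nat (g mod int (p * q))"
  define b where "b = nat (h mod int (p * q))"
  have pos: "p > 0" "q > 0"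
    using assms(1,2) by (simp_all add: prime_gt_0_nat)
  have int_a: "int a = g mod int (p * q)" and int_b: "int b = h mod int (p * q)"
    using pos by (simp_all add: a_def b_def)
  have a_cong: "[int a = g] (mod int (p * q))" and b_cong: "[int b = h] (mod int (p * q))"
    by (simp_all add: int_a int_b cong_def)
  have a_p: "[int a = g] (mod int p)" and a_q: "[int a = g] (mod int q)"
    and b_p: "[int b = h] (mod int p)" and b_q: "[int b = h] (mod int q)"
    using a_cong b_cong by (auto intro: cong_dvd_modulus)
  have "nat (g mod int p) = a mod p" "nat (g mod int q) = a mod q"
    using a_p a_q by (simp_all add: cong_def flip: of_nat_mod)
  hence primroot: "residue_primroot p a" "residue_primroot q a"
    using assms(5,6) by (simp_all add: int_primroot_def)
  have "[int b = int a] (mod int p)" "[int b = int 1] (mod int q)"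
    using a_p b_p b_q assms(7,8) by (auto intro: cong_trans cong_sym)
  hence b_mod: "[b = a] (mod p)" "[b = 1] (mod q)"
    by (simp_all only: cong_int_iff)
  interpret classes: cyclotomic_classes p q a b
    by unfold_locales (fact assms primroot b_mod)+
  obtain c :: "bit alg_closure" where c: "\<And>d. c ^ d = 1 \<longleftrightarrow> p * q dvd d"
    using primitive_root_of_unity_exists assms(1-3) classes.odd_p classes.odd_q by blast
  interpret quaternary_sequence p q a b g h c
    by unfold_locales (use a_cong b_cong c in \<open>auto dest: nat_dvd_not_less\<close>)
  \<comment> \<open>The residues 5 and 1 modulo 8 encode the parity of the quotient by 4, which
    decides whether the multiples of \<open>p\<close> and \<open>q\<close> count.\<close>
  have "odd ((p - 1) div 4)" if "[p = 5] (mod 8)"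
    using that unfolding cong_def by simp presburger
  moreover have "odd ((q - 1) div 4)" if "[q = 5] (mod 8)"
    using that unfolding cong_def by simp presburger
  moreover have "even ((p - 1) div 4)" if "[p = 1] (mod 8)"
    using that unfolding cong_def by simp presburger
  moreover have "even ((q - 1) div 4)" if "[q = 1] (mod 8)"
    using that unfolding cong_def by simp presburger
  \<comment> \<open>Writing the product as \<open>4 * E\<close> and the primes as successors removes
    division and truncated subtraction from the final arithmetic.\<close>
  moreover obtain E where "(p - 1) * (q - 1) = 4 * E"
    using classes.four_dvd(1) by (meson dvd_def dvd_mult2)
  moreover obtain m n where "p = Suc m" "q = Suc n"
    using pos by (meson gr0_implies_Suc)
  ultimately show ?thesis
    using linear_complexity_quat_seq by auto
qed

end
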